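(* Let $n$ and $d$ be positive integers with $d<n-1$. An additive quaternary $[n,2.5,d]$-code exists if and only if $$3(n-d)\geq \lceil d/2\rceil +\lceil d/4\rceil +\lceil d/8\rceil .$$
   Context: For $k$ with $2k$ a positive integer, an additive quaternary $[n,k,d]$-code is a $2k$-dimensional $\mathbb{F}_2$-linear subspace $C$ of $\mathbb{F}_2^{2n}$ whose coordinates are grouped into $n$ consecutive pairs, so that codewords are viewed as $n$-tuples with entries in $\mathbb{F}_2^2$; $n$ is the length, $k$ the (quaternary) dimension, and $d$ the minimum Hamming distance of $C$ measured over these $n$ symbols in $\mathbb{F}_2^2$ (i.e. the minimum number of nonzero pairs in a nonzero codeword). Thus a $[n,2.5,d]$-code is a $5$-dimensional $\mathbb{F}_2$-space of such $n$-tuples. *)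

theory Defs
  imports "HOL-Library.Z2" "Jordan_Normal_Form.VS_Connect" Complex_Main
begin

text \<open>
  The field with two elements is the type \<^typ>\<open>bit\<close>, and its 2n-dimensional coordinate space is
  \<^term>\<open>module_vec TYPE(bit) (2 * n)\<close>, with carrier \<^term>\<open>carrier_vec (2 * n) :: bit vec set\<close>.
  Indices start at 0, so the i-th symbol of a word (for i < n) consists of the coordinates
  2i and 2i + 1.
\<close>

definition symbol :: "bit vec \<Rightarrow> nat \<Rightarrow> bit \<times> bit" where
  "symbol x i = (x $ (2 * i), x $ (2 * i + 1))"

definition hamming_dist :: "nat \<Rightarrow> bit vec \<Rightarrow> bit vec \<Rightarrow> nat" where
  "hamming_dist n x y = card {i. i < n \<and> symbol x i \<noteq> symbol y i}"

text \<open>Meaningful only for codes with at least two words, since \<^const>\<open>Min\<close> is unspecified on the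
  empty set; \<open>additive_quaternary_code\<close> below guarantees this by \<open>k > 0\<close>.\<close>

definition min_dist :: "nat \<Rightarrow> bit vec set \<Rightarrow> nat" where
  "min_dist n C = Min {hamming_dist n x y | x y. x \<in> C \<and> y \<in> C \<and> x \<noteq> y}"

text \<open>The quaternary dimension \<open>k\<close> is half the dimension over the two-element field, so it may be
  a half-integer.\<close>

definition additive_quaternary_code :: "nat \<Rightarrow> real \<Rightarrow> nat \<Rightarrow> bit vec set \<Rightarrow> bool" where
  "additive_quaternary_code n k d C \<longleftrightarrow>
     k > 0 \<and>
     VectorSpace.subspace class_ring C (module_vec TYPE(bit) (2 * n)) \<and>
     real (vectorspace.dim class_ring (module_vec TYPE(bit) (2 * n)\<lparr>carrier := C\<rparr>)) = 2 * k \<and>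
     min_dist n C = d"

end

theory Submission
  imports Defs
begin

text \<open>Concatenating an additive \<open>[n, 2.5, d]\<close>-code with the binary \<open>[3, 2, 2]\<close>-code gives a binary
  linear \<open>[3n, 5, 2d]\<close>-code, and the condition on \<open>n\<close> and \<open>d\<close> is the Griesmer bound for it.

  Conversely, a code is a list of \<open>n\<close> lines in PG(4,2), and its minimum distance is at least \<open>d\<close> iff
  each hyperplane contains at most \<open>s = n - d\<close> of the lines. Adding the 31 lines of a Singer orbit
  increases \<open>s\<close> by 7 and \<open>d\<close> by 24, so it suffices to give the longest list for each \<open>s\<close> from 2 to 8.
  These lists, except the Singer orbit itself (\<open>s = 7\<close>), were found by computer search.\<close>

section \<open>Dimension and cardinality of binary spaces\<close>

lemma (in vectorspace) card_carrier_eq_power_dim: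
  assumes "finite (carrier K)" and "fin_dim"
  shows "card (carrier V) = card (carrier K) ^ dim"
proof -
  obtain B where B: "finite B" "basis B"
    using finite_basis_exists[OF assms(2)] by blast
  then have sub: "B \<subseteq> carrier V"
    by (simp add: basis_def)
  have unique: "\<forall>v. v \<in> carrier V \<longrightarrow> (\<exists>!a. a \<in> B \<rightarrow>\<^sub>E carrier K \<and> lincomb a B = v)"
    using basis_criterion[OF B(1) sub] B(2) by blast
  have in_V: "lincomb a B \<in> carrier V" if "a \<in> B \<rightarrow>\<^sub>E carrier K" for a
    using that sub by (intro lincomb_closed) auto
  \<comment> \<open>Coordinates with respect to \<open>B\<close>: extensional coefficient functions
    make the representation unique and are easy to count.\<close>
  have "bij_betw (\<lambda>a. lincomb a B) (B \<rightarrow>\<^sub>E carrier K) (carrier V)"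
    unfolding bij_betw_def inj_on_def image_def using unique in_V by blast
  then have "card (carrier V) = card (B \<rightarrow>\<^sub>E carrier K)"
    by (simp add: bij_betw_same_card)
  also have "\<dots> = card (carrier K) ^ card B"
    using B(1) by (simp add: card_PiE)
  finally show ?thesis
    using dim_basis[OF B] by simp
qed

lemma (in vectorspace) fin_dim_of_finite_carrier:
  assumes "finite (carrier V)"
  shows "fin_dim"
  unfolding fin_dim_def
  using assms span_is_subset2[of "carrier V"] in_own_span[of "carrier V"] by blast

lemma UNIV_bit: "(UNIV :: bit set) = {0, 1}"
  using bit_not_zero_iff by blast

text \<open>Both directions of the theorem use the dimension of a code only through this count of
  its words.\<close>

lemma card_bit_subspace:
  fixes C :: "bit vec set"
  assumes "VectorSpace.subspace class_ring C (module_vec TYPE(bit) m)"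
  shows "card C = 2 ^ vectorspace.dim class_ring (module_vec TYPE(bit) m\<lparr>carrier := C\<rparr>)"
proof -
  interpret vec_space "TYPE(bit)" m .
  interpret W: vectorspace class_ring "module_vec TYPE(bit) m\<lparr>carrier := C\<rparr>"
    using subspace_is_vs[OF assms] .
  have "C \<subseteq> carrier_vec m"
    using assms by (auto simp: VectorSpace.subspace_def submodule_def module_vec_def)
  moreover have "finite (carrier_vec m :: bit vec set)"
  proof -
    have "carrier_vec m \<subseteq> vec_of_list ` {xs :: bit list. set xs \<subseteq> UNIV \<and> length xs = m}"
      by (auto intro!: image_eqI[of _ _ "list_of_vec _"] simp: vec_list)
    then show ?thesis
      using finite_lists_length_eq[of "UNIV :: bit set" m] by (simp add: UNIV_bit finite_subset)
  qed
  ultimately have "finite C"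
    by (rule finite_subset)
  then have "W.fin_dim"
    using W.fin_dim_of_finite_carrier by simp
  moreover have "finite (carrier class_ring :: bit set)" "card (carrier class_ring :: bit set) = 2"
    by (simp_all add: class_field_def UNIV_bit)
  ultimately have "card (carrier (module_vec TYPE(bit) m\<lparr>carrier := C\<rparr>)) = 2 ^ W.dim"
    using W.card_carrier_eq_power_dim by metis
  then show ?thesis
    by simp
qed

text \<open>The only scalars are 0 and 1, so closure under scalar multiplication comes for free once
  the zero vector is in \<open>C\<close>.\<close>

lemma bit_subspaceI:
  fixes C :: "bit vec set"
  assumes "C \<subseteq> carrier_vec m" and "0\<^sub>v m \<in> C" and "\<And>x y. x \<in> C \<Longrightarrow> y \<in> C \<Longrightarrow> x + y \<in> C"
  shows "VectorSpace.subspace class_ring C (module_vec TYPE(bit) m)"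
proof -
  interpret vec_space "TYPE(bit)" m .
  have smult: "c \<cdot>\<^sub>v x \<in> C" if "x \<in> C" for c :: bit and x
  proof (cases c)
    case zero
    then have "c \<cdot>\<^sub>v x = 0\<^sub>v m" using that assms(1) by auto
    then show ?thesis using assms(2) by simp
  next
    case one
    then have "c \<cdot>\<^sub>v x = x" by auto
    then show ?thesis using that by simp
  qed
  show ?thesis
    unfolding VectorSpace.subspace_def submodule_def
    using assms smult module_axioms vectorspace_axioms by (auto simp: module_vec_def)
qed


section \<open>The Griesmer bound for families of sets\<close>

text \<open>This is the Griesmer sum of ceil(d / 2^i) over i < k; halving with upward rounding can
  be iterated because nested ceilings collapse.\<close>

primrec griesmer :: "nat \<Rightarrow> nat \<Rightarrow> nat" where
  "griesmer 0 d = 0"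
| "griesmer (Suc k) d = d + griesmer k ((d + 1) div 2)"

lemma griesmer_mono: "d \<le> e \<Longrightarrow> griesmer k d \<le> griesmer k e"
proof (induction k arbitrary: d e)
  case (Suc k)
  have "(d + 1) div 2 \<le> (e + 1) div 2"
    using Suc.prems by (intro div_le_mono) simp
  then show ?case
    using Suc.IH Suc.prems by (simp add: add_mono)
qed simp

text \<open>Words are identified with their supports, so that sums become symmetric differences. The induction
  passes to the residual family \<open>{B - A. B \<in> F}\<close> for a nonempty \<open>A \<in> F\<close> of least cardinality.\<close>

theorem griesmer_bound:
  assumes "finite X" and "F \<subseteq> Pow X" and "card F = 2 ^ k"
    and "\<And>A B. A \<in> F \<Longrightarrow> B \<in> F \<Longrightarrow> sym_diff A B \<in> F"
    and "\<And>A. A \<in> F \<Longrightarrow> A \<noteq> {} \<Longrightarrow> d \<le> card A"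
  shows "griesmer k d \<le> card X"
  using assms
proof (induction k arbitrary: X F d)
  case (Suc k)
  note sym = Suc.prems(4)
  have fin_sub: "finite A" if "A \<in> F" for A
    using that Suc.prems(1,2) finite_subset by blast
  have "finite F"
    using Suc.prems(1,2) by (meson finite_Pow_iff finite_subset)
  have "\<not> F \<subseteq> {{}}"
  proof
    assume "F \<subseteq> {{}}"
    then have "card F \<le> 1"
      using card_mono[of "{{}}" F] by simp
    then show False
      using Suc.prems(3) zero_less_power[of "2::nat" k] unfolding power_Suc by linarith
  qed
  then obtain A0 where "A0 \<in> F \<and> A0 \<noteq> {}"
    by blast
  from ex_has_least_nat[of "\<lambda>A. A \<in> F \<and> A \<noteq> {}", OF this, of card]
  obtain A where A: "A \<in> F" "A \<noteq> {}"
    and least: "\<And>B. B \<in> F \<Longrightarrow> B \<noteq> {} \<Longrightarrow> card A \<le> card B"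
    by blast
  \<comment> \<open>A proper nonempty subset \<open>B\<close> of \<open>A\<close> in
    \<open>F\<close> would put the smaller nonempty set \<open>A - B\<close> into
    \<open>F\<close>.\<close>
  have below: "B = {} \<or> B = A" if "B \<in> F" "B \<subseteq> A" for B
  proof (rule ccontr)
    assume B: "\<not> (B = {} \<or> B = A)"
    have "sym_diff A B = A - B" "A - B \<noteq> {}"
      using that B by blast+
    then have "card A \<le> card (A - B)"
      using least sym[OF A(1) that(1)] by metis
    moreover have "card (A - B) < card A"
      using that B fin_sub A by (intro psubset_card_mono) auto
    ultimately show False by simp
  qed
  let ?r = "\<lambda>B. B - A"
  \<comment> \<open>Members that agree outside \<open>A\<close> differ by a member of
    \<open>F\<close> inside \<open>A\<close>, hence by \<open>{}\<close> or \<open>A\<close>. So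
    \<open>?r\<close> is two-to-one on \<open>F\<close>.\<close>
  have fibre: "{B' \<in> F. ?r B' = ?r B} = {B, sym_diff B A}" if "B \<in> F" for B
  proof (intro equalityI subsetI)
    fix B' assume B': "B' \<in> {B' \<in> F. ?r B' = ?r B}"
    then have "sym_diff B B' = {} \<or> sym_diff B B' = A"
      using that by (intro below sym) auto
    then show "B' \<in> {B, sym_diff B A}"
      by blast
  qed (use that A sym in auto)
  have card_fibre: "card {B' \<in> F. ?r B' = ?r B} = 2" if "B \<in> F" for B
  proof -
    have "B \<noteq> sym_diff B A"
      using A(2) by blast
    then show ?thesis
      by (simp add: fibre[OF that])
  qed
  have "card F = (\<Sum>S\<in>?r ` F. card {B' \<in> F. ?r B' = S})"
    using sum.image_gen[OF \<open>finite F\<close>, of "\<lambda>_. 1::nat" ?r] by simp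
  also have "\<dots> = (\<Sum>S\<in>?r ` F. 2)"
    by (intro sum.cong) (auto simp: card_fibre)
  finally have "card F = 2 * card (?r ` F)"
    by simp
  then have card_r: "card (?r ` F) = 2 ^ k"
    using Suc.prems(3) by simp
  have "A \<subseteq> X"
    using A(1) Suc.prems(2) by blast
  \<comment> \<open>The induction hypothesis is used with \<open>card A\<close> in the role of
    \<open>d\<close>; monotonicity of \<open>griesmer\<close> returns to \<open>d\<close> at the
    end.\<close>
  have "griesmer k ((card A + 1) div 2) \<le> card (X - A)"
  proof (rule Suc.IH[of "X - A" "?r ` F"])
    show "?r ` F \<subseteq> Pow (X - A)"
      using Suc.prems(2) by blast
    fix S T assume "S \<in> ?r ` F"
    then obtain B where B: "B \<in> F" "S = B - A"
      by blast
    {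
      assume "T \<in> ?r ` F"
      then obtain B' where B': "B' \<in> F" "T = B' - A"
        by blast
      have "sym_diff S T = sym_diff B B' - A"
        using B(2) B'(2) by blast
      then show "sym_diff S T \<in> ?r ` F"
        using sym[OF B(1) B'(1)] by blast
    }
    assume "S \<noteq> {}"
    \<comment> \<open>The two sets together have 2 * card S + card A elements, and at least 2 * card
      A, so \<open>S\<close> has at least half as many elements as \<open>A\<close>.\<close>
    then have "card A \<le> card B" "card A \<le> card (sym_diff B A)"
      using B A sym by (auto intro!: least)
    moreover have "card B = card (B \<inter> A) + card S"
      unfolding B(2) using fin_sub[OF B(1)] card_Un_disjoint[of "B \<inter> A" "B - A"]
      by (simp add: Int_Diff_Un Int_Diff_disjoint)
    moreover have "card (sym_diff B A) = card S + card (A - B)"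
      unfolding B(2) using fin_sub[OF B(1)] fin_sub[OF A(1)] by (intro card_Un_disjoint) auto
    moreover have "card A = card (A \<inter> B) + card (A - B)"
      using fin_sub[OF A(1)] card_Un_disjoint[of "A \<inter> B" "A - B"]
      by (simp add: Int_Diff_Un Int_Diff_disjoint)
    ultimately show "(card A + 1) div 2 \<le> card S"
      by (simp add: Int_commute)
  qed (use Suc.prems(1) card_r in auto)
  then have "griesmer (Suc k) (card A) \<le> card A + card (X - A)"
    by simp
  also have "\<dots> = card X"
    using \<open>A \<subseteq> X\<close> Suc.prems(1) by (simp add: card_Diff_subset card_mono finite_subset)
  finally show ?case
    using griesmer_mono[of d "card A" "Suc k"] Suc.prems(5) A by (meson order.trans)
qed simp

section \<open>Points, lines and hyperplanes of PG(4,2) in binary digits\<close>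

fun parity :: "nat \<Rightarrow> bool" where
  "parity n = (if n = 0 then False else odd n \<noteq> parity (n div 2))"

declare parity.simps [simp del]

lemma parity_rec: "parity n \<longleftrightarrow> odd n \<noteq> parity (n div 2)"
  using parity.simps[of n] parity.simps[of 0] by (cases "n = 0") auto

text \<open>Reads the parity off the digits of a numeral, so that the simplifier can evaluate the
  incidences in the explicit lists.\<close>

lemma parity_numeral [simp]:
  "\<not> parity 0"
  "parity 1"
  "parity (Suc 0)"
  "parity (numeral (Num.Bit0 m)) \<longleftrightarrow> parity (numeral m)"
  "parity (numeral (Num.Bit1 m)) \<longleftrightarrow> \<not> parity (numeral m)"
  by (simp_all add: parity.simps[of 0] parity.simps[of 1] parity.simps[of "Suc 0"]
      parity_rec[of "numeral (Num.Bit0 m)"] parity_rec[of "numeral (Num.Bit1 m)"])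

lemma parity_xor: "parity (xor m n) \<longleftrightarrow> parity m \<noteq> parity n"
proof (induction m arbitrary: n rule: parity.induct)
  case (1 m)
  show ?case
  proof (cases "m = 0")
    case False
    have "xor m n div 2 = xor (m div 2) (n div 2)"
      by (rule bit_eqI) (simp flip: bit_Suc add: bit_xor_iff)
    moreover have "odd (xor m n) \<longleftrightarrow> odd m \<noteq> odd n"
      by (simp add: even_xor_iff)
    ultimately show ?thesis
      using 1[OF False] parity_rec[of "xor m n"] parity_rec[of m] parity_rec[of n] by metis
  qed simp
qed

text \<open>Natural numbers below 32 stand for vectors of length 5 over the two-element field, read off
  from their binary digits; \<^term>\<open>parity (and u a)\<close> is the standard bilinear form. A pair \<open>(a, b)\<close>
  stands for the line through the points \<open>a\<close> and \<open>b\<close>, possibly degenerate, and a nonzero \<open>u\<close> for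
  the hyperplane orthogonal to it.\<close>

definition contains :: "nat \<Rightarrow> nat \<times> nat \<Rightarrow> bool" where
  "contains u l \<longleftrightarrow> \<not> parity (and u (fst l)) \<and> \<not> parity (and u (snd l))"

definition weight :: "nat \<Rightarrow> (nat \<times> nat) list \<Rightarrow> nat" where
  "weight u L = length (filter (\<lambda>l. \<not> contains u l) L)"

definition lines_in :: "nat \<Rightarrow> (nat \<times> nat) list \<Rightarrow> nat" where
  "lines_in u L = length (filter (contains u) L)"

definition arrangement :: "nat \<Rightarrow> (nat \<times> nat) list \<Rightarrow> bool" where
  "arrangement s L \<longleftrightarrow> (\<forall>u\<in>{1..<32}. lines_in u L \<le> s)"

text \<open>The points of the pairs are the columns of a generator matrix, and \<open>u\<close> is
  the message.\<close>

definition codeword :: "(nat \<times> nat) list \<Rightarrow> nat \<Rightarrow> bit vec" where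
  "codeword L u =
    vec (2 * length L)
      (\<lambda>j. of_bool (parity (and u ((if even j then fst else snd) (L ! (j div 2))))))"

lemma parity_and_xor: "parity (and (xor u v) a) \<longleftrightarrow> parity (and u a) \<noteq> parity (and v a)"
proof -
  have "and (xor u v) a = xor (and u a) (and v a)"
    by (rule bit_eqI) (auto simp: bit_simps)
  then show ?thesis
    by (simp add: parity_xor)
qed

lemma codeword_xor: "codeword L (xor u v) = codeword L u + codeword L v"
  by (rule eq_vecI) (auto simp: codeword_def parity_and_xor)

lemma codeword_0: "codeword L 0 = 0\<^sub>v (2 * length L)"
  by (rule eq_vecI) (auto simp: codeword_def)

text \<open>The words agree in symbol i iff \<open>xor u v\<close> annihilates both points of
  \<open>L ! i\<close>; distances thus become incidence counts.\<close>

lemma hamming_dist_codeword: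
  "hamming_dist (length L) (codeword L u) (codeword L v) = weight (xor u v) L"
proof -
  have "symbol (codeword L u) i \<noteq> symbol (codeword L v) i \<longleftrightarrow> \<not> contains (xor u v) (L ! i)"
    if "i < length L" for i
    using that by (auto simp: symbol_def codeword_def contains_def parity_and_xor)
  then show ?thesis
    unfolding hamming_dist_def weight_def length_filter_conv_card
    by (intro arg_cong[where f = card]) auto
qed

lemma xor_less_32: "u < 32 \<Longrightarrow> v < 32 \<Longrightarrow> xor u v < (32 :: nat)"
  using take_bit_nat_eq_self_iff[of 5 u] take_bit_nat_eq_self_iff[of 5 v]
    take_bit_nat_eq_self_iff[of 5 "xor u v"] by simp

section \<open>Explicit arrangements for s from 2 to 8\<close>

lemma lines_in_Nil: "lines_in u [] = 0"
  by (simp add: lines_in_def)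

lemma lines_in_Cons:
  "lines_in u ((a, b) # L) =
     (if parity (and u a) \<or> parity (and u b) then 0 else 1) + lines_in u L"
  by (simp add: lines_in_def contains_def)

text \<open>Listing the 31 hyperplanes turns the check of a concrete list into a finite conjunction
  about numerals.\<close>

lemma arrangement_iff:
  "arrangement s L \<longleftrightarrow> list_all (\<lambda>u. lines_in u L \<le> s)
    [1, 2, 3, 4, 5, 6, 7, 8, 9, 10, 11, 12, 13, 14, 15, 16, 17, 18, 19, 20, 21, 22, 23, 24, 25, 26,
     27, 28, 29, 30, 31]"
  (is "_ \<longleftrightarrow> list_all _ ?us")
proof -
  have us: "?us = [1..<32]"
    by code_simp
  show ?thesis
    unfolding us arrangement_def list.pred_set set_upt ..
qed

lemma arrangement_2:
  "arrangement 2
   [(1, 20), (7, 25), (15, 18), (2, 8), (4, 27), (14, 22), (5, 9), (3, 16)]"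
  by (simp only: arrangement_iff list.pred_inject)
    (simp add: lines_in_Nil lines_in_Cons)

lemma arrangement_3:
  "arrangement 3
   [(1, 28), (3, 17), (12, 22), (5, 11), (13, 19), (6, 9), (7, 24), (10, 16), (3, 4), (8, 16),
     (1, 20)]"
  by (simp only: arrangement_iff list.pred_inject)
    (simp add: lines_in_Nil lines_in_Cons)

lemma arrangement_4:
  "arrangement 4
   [(1, 30), (4, 10), (1, 20), (6, 11), (2, 25), (5, 24), (9, 20), (6, 26), (11, 23), (8, 16),
     (15, 17), (3, 17), (12, 22), (3, 16), (7, 19), (15, 22)]"
  by (simp only: arrangement_iff list.pred_inject)
    (simp add: lines_in_Nil lines_in_Cons)

lemma arrangement_5:
  "arrangement 5
   [(7, 11), (1, 16), (9, 22), (15, 19), (2, 4), (5, 24), (9, 20), (1, 24), (6, 17), (7, 16),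
     (14, 18), (8, 18), (15, 21), (3, 21), (10, 20), (7, 11), (2, 8), (5, 25), (13, 19),
     (4, 27), (3, 13)]"
  by (simp only: arrangement_iff list.pred_inject)
    (simp add: lines_in_Nil lines_in_Cons)

lemma arrangement_6:
  "arrangement 6
   [(6, 25), (2, 8), (4, 10), (15, 18), (13, 23), (2, 20), (3, 20), (7, 8), (8, 17), (1, 26),
     (14, 16), (15, 19), (12, 16), (13, 16), (11, 22), (14, 21), (6, 24), (9, 17), (5, 9),
     (2, 5), (9, 19), (1, 4), (11, 23), (3, 17), (3, 21), (4, 27)]"
  by (simp only: arrangement_iff list.pred_inject)
    (simp add: lines_in_Nil lines_in_Cons)

text \<open>Each line joins two consecutive powers of a primitive root of \<open>x\<^sup>5 + x\<^sup>2 + 1\<close>; the Singer cycle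
  permutes these lines and acts transitively on hyperplanes, so each hyperplane contains
  31 * 7 / 31 = 7 of them.\<close>

definition singer_lines :: "(nat \<times> nat) list" where
  "singer_lines =
   [(1, 2), (2, 4), (4, 8), (8, 16), (16, 5), (5, 10), (10, 20), (20, 13), (13, 26), (26, 17),
     (17, 7), (7, 14), (14, 28), (28, 29), (29, 31), (31, 27), (27, 19), (19, 3), (3, 6),
     (6, 12), (12, 24), (24, 21), (21, 15), (15, 30), (30, 25), (25, 23), (23, 11), (11, 22),
     (22, 9), (9, 18), (18, 1)]"

lemma arrangement_7: "arrangement 7 singer_lines"
  unfolding singer_lines_def
  by (simp only: arrangement_iff list.pred_inject)
    (simp add: lines_in_Nil lines_in_Cons)

lemma arrangement_8:
  "arrangement 8
   [(2, 13), (13, 21), (12, 20), (4, 24), (9, 18), (11, 18), (14, 17), (5, 27), (6, 10),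
     (7, 25), (6, 25), (14, 21), (12, 22), (3, 16), (7, 26), (1, 8), (5, 16), (10, 23),
     (13, 19), (1, 8), (5, 11), (5, 10), (2, 4), (7, 17), (13, 17), (3, 20), (4, 16), (1, 18),
     (1, 2), (10, 16), (11, 22), (15, 23), (9, 22), (2, 28)]"
  by (simp only: arrangement_iff list.pred_inject)
    (simp add: lines_in_Nil lines_in_Cons)

section \<open>From arrangements to codes\<close>

lemma weight_plus_lines_in: "weight u L + lines_in u L = length L"
  using sum_length_filter_compl[of "contains u" L] by (simp add: weight_def lines_in_def)

lemma weight_append: "weight u (K @ L) = weight u K + weight u L"
  by (simp add: weight_def)

lemma lines_in_append: "lines_in u (K @ L) = lines_in u K + lines_in u L"
  by (simp add: lines_in_def)

lemma arrangement_append: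
  assumes "arrangement s K" and "arrangement t L"
  shows "arrangement (s + t) (K @ L)"
  using assms by (simp add: arrangement_def lines_in_append add_mono)

lemma arrangement_take: "arrangement s L \<Longrightarrow> arrangement s (take m L)"
  unfolding arrangement_def
proof (rule ballI)
  fix u :: nat assume "\<forall>u\<in>{1..<32}. lines_in u L \<le> s" "u \<in> {1..<32}"
  then have "lines_in u L \<le> s"
    by blast
  then show "lines_in u (take m L) \<le> s"
    using lines_in_append[of u "take m L" "drop m L"] by simp
qed

lemma weight_zeros: "weight u (replicate m (0, 0)) = 0"
  by (simp add: weight_def contains_def)

lemma hamming_dist_le: "hamming_dist n x y \<le> n"
proof -
  have "hamming_dist n x y \<le> card {..<n}"
    unfolding hamming_dist_def by (intro card_mono) auto
  then show ?thesis
    by simp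
qed

lemma finite_hamming_dists: "finite {hamming_dist n x y | x y. x \<in> C \<and> y \<in> C \<and> x \<noteq> y}"
proof (rule finite_subset)
  show "{hamming_dist n x y | x y. x \<in> C \<and> y \<in> C \<and> x \<noteq> y} \<subseteq> {..n}"
    using hamming_dist_le by blast
qed simp

text \<open>As \<open>d > 0\<close>, the 32 messages have distinct codewords, which gives dimension
  5; \<open>u0\<close> makes the minimum distance exactly \<open>d\<close>.\<close>

lemma code_of_weights:
  assumes "d > 0" and "\<And>u. u \<in> {1..<32} \<Longrightarrow> d \<le> weight u L"
    and "u0 \<in> {1..<32}" and "weight u0 L = d"
  shows "additive_quaternary_code (length L) (5 / 2) d (codeword L ` {..<32})"
proof -
  let ?n = "length L" and ?C = "codeword L ` {..<32}"
  have dist_ge: "d \<le> hamming_dist ?n (codeword L u) (codeword L v)"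
    if "u < 32" "v < 32" "u \<noteq> v" for u v
  proof -
    have "xor u v \<noteq> 0"
      using that(3) by (metis xor.assoc xor.left_neutral xor.right_neutral xor_self_eq)
    then have "xor u v \<in> {1..<32}"
      using xor_less_32[OF that(1,2)] by simp
    then show ?thesis
      by (simp add: hamming_dist_codeword assms(2))
  qed
  have "inj_on (codeword L) {..<32}"
  proof (rule inj_onI, rule ccontr)
    fix u v :: nat
    assume "u \<in> {..<32}" "v \<in> {..<32}" "codeword L u = codeword L v" "u \<noteq> v"
    then show False
      using dist_ge[of u v] \<open>d > 0\<close> by (simp add: hamming_dist_def)
  qed
  then have card: "card ?C = 2 ^ 5"
    by (simp add: card_image)
  have subspace: "VectorSpace.subspace class_ring ?C (module_vec TYPE(bit) (2 * ?n))"
  proof (rule bit_subspaceI)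
    show "?C \<subseteq> carrier_vec (2 * ?n)"
      by (auto simp: codeword_def)
    show "0\<^sub>v (2 * ?n) \<in> ?C"
      by (rule image_eqI[of _ _ 0]) (simp_all add: codeword_0)
    show "x + y \<in> ?C" if "x \<in> ?C" "y \<in> ?C" for x y
      using that xor_less_32 by (auto simp flip: codeword_xor)
  qed
  have dim: "vectorspace.dim class_ring (module_vec TYPE(bit) (2 * ?n)\<lparr>carrier := ?C\<rparr>) = 5"
    using card_bit_subspace[OF subspace] card
    by (metis one_less_numeral_iff power_inject_exp semiring_norm(76))
  have "min_dist ?n ?C = d"
    unfolding min_dist_def
  proof (rule Min_eqI)
    show "finite {hamming_dist ?n x y | x y. x \<in> ?C \<and> y \<in> ?C \<and> x \<noteq> y}"
      by (rule finite_hamming_dists)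
    show "d \<le> w" if "w \<in> {hamming_dist ?n x y | x y. x \<in> ?C \<and> y \<in> ?C \<and> x \<noteq> y}" for w
    proof -
      from that obtain u v where "u < 32" "v < 32" "codeword L u \<noteq> codeword L v"
        "w = hamming_dist ?n (codeword L u) (codeword L v)"
        by blast
      then show ?thesis
        using dist_ge[of u v] by fastforce
    qed
    have dist: "hamming_dist ?n (codeword L u0) (codeword L 0) = d"
      using assms(4) by (simp add: hamming_dist_codeword)
    then have "codeword L u0 \<noteq> codeword L 0"
      using \<open>d > 0\<close> by (auto simp: hamming_dist_def)
    moreover have "codeword L u0 \<in> ?C" "codeword L 0 \<in> ?C"
      using assms(3) by auto
    ultimately show "d \<in> {hamming_dist ?n x y | x y. x \<in> ?C \<and> y \<in> ?C \<and> x \<noteq> y}"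
      using dist by blast
  qed
  then show ?thesis
    using subspace dim by (simp add: additive_quaternary_code_def)
qed

text \<open>Annihilating the symbols one at a time lowers each weight by at most one per step, so the
  minimum weight passes through every value down to 0.\<close>

lemma code_of_arrangement:
  assumes "d > 0" and "arrangement s L" and "length L = s + d"
  shows "\<exists>C. additive_quaternary_code (length L) (5 / 2) d C"
proof -
  define Z where "Z j = replicate j (0, 0) @ drop j L" for j
  have weight_Z: "weight u (Z j) = weight u (drop j L)" for u j
    by (simp add: Z_def weight_append weight_zeros)
  have step: "weight u (Z j) \<le> Suc (weight u (Z (Suc j)))" for u j
  proof (cases "j < length L")
    case True
    then show ?thesis
      using weight_Z by (simp add: Cons_nth_drop_Suc[symmetric] weight_def)
  next
    case False
    then show ?thesis
      by (simp add: weight_Z)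
  qed
  define P where "P j \<longleftrightarrow> (\<exists>u\<in>{1..<32}. weight u (Z j) \<le> d)" for j
  \<comment> \<open>The first stage at which some weight is at most \<open>d\<close>. If
    \<open>j > 0\<close>, all weights exceed \<open>d\<close> one stage earlier, so none falls below
    \<open>d\<close> at stage \<open>j\<close>; at stage 0 the arrangement itself gives
    this.\<close>
  define j where "j = (LEAST j. P j)"
  have "P (length L)"
    unfolding P_def by (intro bexI[of _ 1]) (simp_all add: weight_Z, simp add: weight_def)
  then have "P j" and "j \<le> length L"
    unfolding j_def by (auto intro: LeastI Least_le)
  have ge: "d \<le> weight u (Z j)" if u: "u \<in> {1..<32}" for u
  proof (cases j)
    case 0
    have "lines_in u L \<le> s"
      using assms(2) u unfolding arrangement_def by blast
    then show ?thesis
      using weight_plus_lines_in[of u L] assms(3) 0 by (simp add: Z_def)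
  next
    case (Suc i)
    then have "\<not> P i"
      unfolding j_def using not_less_Least by (metis lessI)
    then have "\<not> weight u (Z i) \<le> d"
      using u unfolding P_def by blast
    then show ?thesis
      using step[of u i] Suc by simp
  qed
  from \<open>P j\<close> obtain u where "u \<in> {1..<32}" "weight u (Z j) \<le> d"
    unfolding P_def by blast
  then have "additive_quaternary_code (length (Z j)) (5 / 2) d (codeword (Z j) ` {..<32})"
    using code_of_weights[of d "Z j" u] ge \<open>d > 0\<close> by (metis order_antisym)
  moreover have "length (Z j) = length L"
    using \<open>j \<le> length L\<close> by (simp add: Z_def)
  ultimately show ?thesis
    by metis
qed

section \<open>Long arrangements for every s from 2 on\<close>

lemma arrangement_exists:
  assumes "2 \<le> s" and "(d + 1) div 2 + (d + 3) div 4 + (d + 7) div 8 \<le> 3 * s"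
  shows "\<exists>L. arrangement s L \<and> s + d \<le> length L"
  using assms
proof (induction s arbitrary: d rule: less_induct)
  case (less s)
  \<comment> \<open>The left side of the numerical condition is monotone in \<open>d\<close>, so a
    single violating value \<open>m\<close> caps \<open>d\<close>.\<close>
  have bound: "d < m" if "3 * s < (m + 1) div 2 + (m + 3) div 4 + (m + 7) div 8" for m
  proof (rule ccontr)
    assume "\<not> d < m"
    then have "(m + 1) div 2 \<le> (d + 1) div 2" "(m + 3) div 4 \<le> (d + 3) div 4"
      "(m + 7) div 8 \<le> (d + 7) div 8"
      by (simp_all add: div_le_mono)
    then show False
      using that less.prems(2) by linarith
  qed
  \<comment> \<open>\<open>s = 8\<close> is a base case because removing a Singer orbit would leave
    s = 1. There the numerical condition allows d = 2, but among three lines any two already lie in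
    a common hyperplane.\<close>
  consider "s = 2" | "s = 3" | "s = 4" | "s = 5" | "s = 6" | "s = 7" | "s = 8" | "9 \<le> s"
    using less.prems(1) by linarith
  then show ?case
  proof cases
    case 1
    then have d: "d \<le> 6"
      using bound[of 7] by simp
    show ?thesis
      unfolding 1 by (rule exI, rule conjI, rule arrangement_2) (use d in simp)
  next
    case 2
    then have d: "d \<le> 8"
      using bound[of 9] by simp
    show ?thesis
      unfolding 2 by (rule exI, rule conjI, rule arrangement_3) (use d in simp)
  next
    case 3
    then have d: "d \<le> 12"
      using bound[of 13] by simp
    show ?thesis
      unfolding 3 by (rule exI, rule conjI, rule arrangement_4) (use d in simp)
  next
    case 4
    then have d: "d \<le> 16"
      using bound[of 17] by simp
    show ?thesis
      unfolding 4 by (rule exI, rule conjI, rule arrangement_5) (use d in simp)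
  next
    case 5
    then have d: "d \<le> 20"
      using bound[of 21] by simp
    show ?thesis
      unfolding 5 by (rule exI, rule conjI, rule arrangement_6) (use d in simp)
  next
    case 6
    then have d: "d \<le> 24"
      using bound[of 25] by simp
    show ?thesis
      unfolding 6 by (rule exI, rule conjI, rule arrangement_7)
        (use d in \<open>simp add: singer_lines_def\<close>)
  next
    case 7
    then have d: "d \<le> 26"
      using bound[of 27] by simp
    show ?thesis
      unfolding 7 by (rule exI, rule conjI, rule arrangement_8) (use d in simp)
  next
    case 8
    \<comment> \<open>Lowering \<open>d\<close> by 24 lowers the three terms by 12 + 6 + 3 = 3 * 7.
      If \<open>d < 24\<close>, the truncated difference is 0, and so is the left side.\<close>
    have "(d - 24 + 1) div 2 + (d - 24 + 3) div 4 + (d - 24 + 7) div 8 \<le> 3 * (s - 7)"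
    proof (cases "24 \<le> d")
      case True
      then obtain e where e: "d = e + 24"
        by (metis add.commute le_Suc_ex)
      have "(e + 24 + 1) div 2 = (e + 1) div 2 + 12" "(e + 24 + 3) div 4 = (e + 3) div 4 + 6"
        "(e + 24 + 7) div 8 = (e + 7) div 8 + 3"
        by presburger+
      then show ?thesis
        using less.prems(2) unfolding e diff_add_inverse2 by linarith
    qed simp
    moreover have "s - 7 < s" "2 \<le> s - 7"
      using 8 by simp_all
    ultimately obtain L where L: "arrangement (s - 7) L" "s - 7 + (d - 24) \<le> length L"
      using less.IH[of "s - 7" "d - 24"] by blast
    have "arrangement (s - 7 + 7) (L @ singer_lines)"
      using L(1) arrangement_7 by (rule arrangement_append)
    moreover have "length singer_lines = 31"
      by (simp add: singer_lines_def)
    ultimately show ?thesis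
      using L(2) 8 by (intro exI[of _ "L @ singer_lines"]) auto
  qed
qed

section \<open>Necessity: concatenation with the binary [3,2,2] code\<close>

definition nonzero_functionals :: "(bit \<times> bit) set" where
  "nonzero_functionals = {(1, 0), (0, 1), (1, 1)}"

text \<open>Concatenation with the binary [3,2,2] code: the support of the word obtained by replacing
  each symbol by its values under the three nonzero functionals.\<close>

definition support :: "nat \<Rightarrow> bit vec \<Rightarrow> (nat \<times> bit \<times> bit) set" where
  "support n x =
    (SIGMA i : {..<n}. {(a, b) \<in> nonzero_functionals. a * x $ (2 * i) + b * x $ (2 * i + 1) = 1})"

lemma bit_add_eq_1_iff: "p + q = 1 \<longleftrightarrow> (p = 1) \<noteq> (q = 1)" for p q :: bit
  by (cases p; cases q) simp_all

lemma support_add: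
  assumes "x \<in> carrier_vec (2 * n)" and "y \<in> carrier_vec (2 * n)"
  shows "support n (x + y) = sym_diff (support n x) (support n y)"
proof -
  have "(a * (x + y) $ (2 * i) + b * (x + y) $ (2 * i + 1) = 1) \<longleftrightarrow>
      (a * x $ (2 * i) + b * x $ (2 * i + 1) = 1) \<noteq> (a * y $ (2 * i) + b * y $ (2 * i + 1) = 1)"
    if "i < n" for a b i
  proof -
    have "(x + y) $ (2 * i) = x $ (2 * i) + y $ (2 * i)"
      "(x + y) $ (2 * i + 1) = x $ (2 * i + 1) + y $ (2 * i + 1)"
      using assms that by simp_all
    then have "a * (x + y) $ (2 * i) + b * (x + y) $ (2 * i + 1) =
        (a * x $ (2 * i) + b * x $ (2 * i + 1)) + (a * y $ (2 * i) + b * y $ (2 * i + 1))"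
      by (simp only: distrib_left add.assoc add.left_commute)
    then show ?thesis
      by (simp only: bit_add_eq_1_iff)
  qed
  then show ?thesis
    unfolding support_def by blast
qed

text \<open>A nonzero symbol takes the value 1 under exactly two of the three nonzero
  functionals.\<close>

lemma card_support:
  assumes "x \<in> carrier_vec (2 * n)"
  shows "card (support n x) = 2 * hamming_dist n x (0\<^sub>v (2 * n))"
proof -
  have "card {(a, b) \<in> nonzero_functionals. a * p + b * q = 1} = (if (p, q) = (0, 0) then 0 else 2)"
    for p q :: bit
  proof (cases p; cases q)
    assume "p = 0" "q = 0"
    then show ?thesis by simp
  next
    assume pq: "p = 0" "q = 1"
    then have "{(a, b) \<in> nonzero_functionals. a * p + b * q = 1} = {(0, 1), (1, 1)}"
      by (auto simp: nonzero_functionals_def)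
    then show ?thesis using pq by simp
  next
    assume pq: "p = 1" "q = 0"
    then have "{(a, b) \<in> nonzero_functionals. a * p + b * q = 1} = {(1, 0), (1, 1)}"
      by (auto simp: nonzero_functionals_def)
    then show ?thesis using pq by simp
  next
    assume pq: "p = 1" "q = 1"
    then have "{(a, b) \<in> nonzero_functionals. a * p + b * q = 1} = {(1, 0), (0, 1)}"
      by (auto simp: nonzero_functionals_def)
    then show ?thesis using pq by simp
  qed
  moreover have "finite {(a, b) \<in> nonzero_functionals. P a b}" for P
    by (rule finite_subset[of _ nonzero_functionals]) (auto simp: nonzero_functionals_def)
  ultimately have "card (support n x) = (\<Sum>i<n. if symbol x i = (0, 0) then 0 else 2)"
    unfolding support_def symbol_def by (subst card_SigmaI) simp_all
  also have "\<dots> = (\<Sum>i | i < n \<and> symbol x i \<noteq> (0, 0). 2)"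
    by (intro sum.mono_neutral_cong_right) auto
  also have "{i. i < n \<and> symbol x i \<noteq> (0, 0)} = {i. i < n \<and> symbol x i \<noteq> symbol (0\<^sub>v (2 * n)) i}"
    by (auto simp: symbol_def)
  finally show ?thesis
    by (simp add: hamming_dist_def)
qed

lemma hamming_dist_ge_min_dist:
  assumes "x \<in> C" and "y \<in> C" and "x \<noteq> y"
  shows "min_dist n C \<le> hamming_dist n x y"
  unfolding min_dist_def
proof (rule Min_le)
  show "finite {hamming_dist n x y | x y. x \<in> C \<and> y \<in> C \<and> x \<noteq> y}"
    by (rule finite_hamming_dists)
qed (use assms in blast)

text \<open>The supports of the words form a family of 2^k subsets of a set with 3n elements, closed
  under symmetric difference, whose nonempty members have at least 2d elements.\<close>

lemma additive_code_griesmer: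
  assumes "additive_quaternary_code n (real k / 2) d C" and "d > 0"
  shows "griesmer k (2 * d) \<le> 3 * n"
proof -
  have subspace: "VectorSpace.subspace class_ring C (module_vec TYPE(bit) (2 * n))"
    and "vectorspace.dim class_ring (module_vec TYPE(bit) (2 * n)\<lparr>carrier := C\<rparr>) = k"
    and d: "min_dist n C = d"
    using assms by (auto simp: additive_quaternary_code_def)
  then have card: "card C = 2 ^ k"
    using card_bit_subspace by metis
  have C: "C \<subseteq> carrier_vec (2 * n)" "0\<^sub>v (2 * n) \<in> C" and add: "\<And>x y. x \<in> C \<Longrightarrow> y \<in> C \<Longrightarrow> x + y \<in> C"
    using subspace unfolding VectorSpace.subspace_def submodule_def by (auto simp: module_vec_def)
  have large: "2 * d \<le> card (support n x)" if "x \<in> C" "x \<noteq> 0\<^sub>v (2 * n)" for x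
    using hamming_dist_ge_min_dist[OF that(1) C(2) that(2), of n] d card_support[of x n] that C(1)
    by auto
  \<comment> \<open>Equal supports give \<open>x + y\<close> empty support. By \<open>large\<close>
    this forces \<open>x + y\<close> to be zero, that is \<open>x = y\<close> in characteristic
    2.\<close>
  have "inj_on (support n) C"
  proof (rule inj_onI, rule ccontr)
    fix x y assume xy: "x \<in> C" "y \<in> C" "support n x = support n y" "x \<noteq> y"
    then have "support n (x + y) = {}"
      using support_add[of x n y] C(1) by auto
    moreover have "x + y \<noteq> 0\<^sub>v (2 * n)"
    proof
      assume eq: "x + y = 0\<^sub>v (2 * n)"
      have "x = y"
      proof (rule eq_vecI)
        show "dim_vec x = dim_vec y"
          using xy(1,2) C(1) by (metis carrier_vecD subsetD)
        fix i assume "i < dim_vec y"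
        then have "x $ i + y $ i = 0"
          using xy(2) C(1) eq by (metis carrier_vecD index_add_vec(1) index_zero_vec(1) subsetD)
        then show "x $ i = y $ i"
          by (cases "x $ i"; cases "y $ i") simp_all
      qed
      then show False using xy(4) by simp
    qed
    ultimately show False
      using large[OF add[OF xy(1,2)]] \<open>d > 0\<close> by simp
  qed
  then have "card (support n ` C) = 2 ^ k"
    using card by (simp add: card_image)
  then have "griesmer k (2 * d) \<le> card ({..<n} \<times> nonzero_functionals)"
  proof (rule griesmer_bound[rotated 2])
    show "finite ({..<n} \<times> nonzero_functionals)"
      by (simp add: nonzero_functionals_def)
    show "support n ` C \<subseteq> Pow ({..<n} \<times> nonzero_functionals)"
      by (auto simp: support_def)
    show "sym_diff A B \<in> support n ` C" if "A \<in> support n ` C" "B \<in> support n ` C" for A B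
    proof -
      from that obtain x y where "x \<in> C" "y \<in> C" "A = support n x" "B = support n y"
        by blast
      then show ?thesis
        using support_add[of x n y] C(1) add by (intro image_eqI[of _ _ "x + y"]) auto
    qed
    show "2 * d \<le> card A" if "A \<in> support n ` C" "A \<noteq> {}" for A
    proof -
      from that(1) obtain x where x: "x \<in> C" "A = support n x"
        by blast
      then have "x \<noteq> 0\<^sub>v (2 * n)"
        using that(2) by (auto simp: support_def)
      then show ?thesis
        using large x by simp
    qed
  qed
  then show ?thesis
    by (simp add: nonzero_functionals_def card_cartesian_product mult.commute)
qed

section \<open>Ceilings and the equivalence\<close>

lemma ceiling_real_div_nat:
  assumes "b > 0"
  shows "\<lceil>real a / real b\<rceil> = int ((a + (b - 1)) div b)"
proof -
  define q r where "q = (a + (b - 1)) div b" and "r = (a + (b - 1)) mod b"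
  have "q * b + r = a + (b - 1)" and r: "r < b"
    using assms unfolding q_def r_def by (simp_all only: div_mult_mod_eq mod_less_divisor)
  then have "a + b = q * b + r + 1"
    using assms by linarith
  then have "real (a + b) = real (q * b + r + 1)"
    by (rule arg_cong)
  then have "real a + real b = real q * real b + real r + 1"
    by simp
  moreover have "real r + 1 \<le> real b"
    using r by simp
  ultimately show ?thesis
    unfolding q_def[symmetric] using assms
    by (intro ceiling_unique)
      (simp_all add: pos_less_divide_eq pos_divide_le_eq left_diff_distrib)
qed

theorem theorem2:
  fixes n d :: nat
  assumes "n > 0" and "d > 0" and "d < n - 1"
  shows "(\<exists>C. additive_quaternary_code n (5 / 2) d C) \<longleftrightarrow>
    3 * (int n - int d) \<ge> \<lceil>real d / 2\<rceil> + \<lceil>real d / 4\<rceil> + \<lceil>real d / 8\<rceil>"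
proof -
  have "\<lceil>real d / 2\<rceil> = int ((d + 1) div 2)" "\<lceil>real d / 4\<rceil> = int ((d + 3) div 4)"
    "\<lceil>real d / 8\<rceil> = int ((d + 7) div 8)"
    using ceiling_real_div_nat[of 2 d] ceiling_real_div_nat[of 4 d] ceiling_real_div_nat[of 8 d]
    by simp_all
  then have bound_iff: "3 * (int n - int d) \<ge> \<lceil>real d / 2\<rceil> + \<lceil>real d / 4\<rceil> + \<lceil>real d / 8\<rceil> \<longleftrightarrow>
      (d + 1) div 2 + (d + 3) div 4 + (d + 7) div 8 \<le> 3 * (n - d)" (is "_ \<longleftrightarrow> ?bound")
    using assms(3) by simp linarith
  have "?bound" if "additive_quaternary_code n (5 / 2) d C" for C
  proof -
    have "griesmer 5 (2 * d) \<le> 3 * n"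
      using additive_code_griesmer[of n 5 d C] that \<open>d > 0\<close> by simp
    \<comment> \<open>The first two terms add up to 3d; moved to the other side, they turn 3n into
      3(n - d).\<close>
    moreover have "griesmer 5 (2 * d) = 2 * d + d + (d + 1) div 2 + (d + 3) div 4 + (d + 7) div 8"
    proof -
      have five: "(5 :: nat) = Suc (Suc (Suc (Suc (Suc 0))))"
        by simp
      have "(2 * d + 1) div 2 = d" "((d + 1) div 2 + 1) div 2 = (d + 3) div 4"
        "((d + 3) div 4 + 1) div 2 = (d + 7) div 8"
        by presburger+
      then show ?thesis
        unfolding five griesmer.simps by simp
    qed
    ultimately show ?thesis
      using assms(3) by linarith
  qed
  moreover have "\<exists>C. additive_quaternary_code n (5 / 2) d C" if bound: "?bound"
  proof -
    \<comment> \<open>This is where \<open>d < n - 1\<close> excludes s = 1. The list found may be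
      too long and is cut to exactly \<open>n\<close> lines.\<close>
    have "2 \<le> n - d"
      using assms(3) by linarith
    then obtain L where L: "arrangement (n - d) L" "n - d + d \<le> length L"
      using arrangement_exists[OF _ bound] by blast
    then show ?thesis
      using code_of_arrangement[OF \<open>d > 0\<close> arrangement_take[OF L(1), of n]] assms(3) by simp
  qed
  ultimately show ?thesis
    unfolding bound_iff by blast
qed

end
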